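(* Let $n\geq 4$ and $A\in\mathcal{PC}_n$. Then, for any $p\in\{1,\ldots,n\}$, $$\mathcal{E}(A)=\bigcup_{i=1}^{n}\mathcal{E}(A;i)=\bigcup_{i=1,\ i\neq p}^{n}\mathcal{E}(A;i).$$
   Context: $\mathcal{PC}_n$ is the set of $n$-by-$n$ reciprocal matrices: entrywise positive real matrices $A=[a_{ij}]$ with $a_{ji}=1/a_{ij}$ for all $1\leq i,j\leq n$. $\mathcal{V}_n$ is the set of entrywise positive real $n$-vectors. A vector $w\in\mathcal{V}_n$ is efficient for $A\in\mathcal{PC}_n$ if for every $v\in\mathcal{V}_n$, the entrywise inequalities $\left|a_{ij}-\frac{v_i}{v_j}\right|\leq\left|a_{ij}-\frac{w_i}{w_j}\right|$ for all $i,j$ imply that $v$ is proportional to $w$. $\mathcal{E}(A)$ is the set of all efficient vectors for $A$. $A(i)$ is the principal submatrix of $A$ obtained by deleting row and column $i$, and $w(i)$ is the vector obtained from $w$ by deleting its $i$th entry. (If $A$ is reciprocal, so is $A(i)$.) $\mathcal{E}(A;i)$ is the set of $w\in\mathcal{E}(A)$ such that $w(i)\in\mathcal{E}(A(i))$. *)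

theory Defs
  imports "Jordan_Normal_Form.Determinant"
begin

(* Rows, columns and vector entries are indexed by 0, ..., n - 1 instead of 1, ..., n. *)

definition reciprocal_mats :: "nat \<Rightarrow> real mat set" where
  "reciprocal_mats n = {A \<in> carrier_mat n n.
     \<forall>i<n. \<forall>j<n. A $$ (i, j) > 0 \<and> A $$ (j, i) = 1 / A $$ (i, j)}"

definition pos_vecs :: "nat \<Rightarrow> real vec set" where
  "pos_vecs n = {w \<in> carrier_vec n. \<forall>i<n. w $ i > 0}"

definition proportional :: "real vec \<Rightarrow> real vec \<Rightarrow> bool" where
  "proportional v w \<longleftrightarrow> (\<exists>c. v = c \<cdot>\<^sub>v w)"

definition efficient :: "real mat \<Rightarrow> real vec \<Rightarrow> bool" where
  "efficient A w \<longleftrightarrow> w \<in> pos_vecs (dim_row A) \<and>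
     (\<forall>v \<in> pos_vecs (dim_row A).
        (\<forall>i < dim_row A. \<forall>j < dim_row A.
           \<bar>A $$ (i, j) - v $ i / v $ j\<bar> \<le> \<bar>A $$ (i, j) - w $ i / w $ j\<bar>)
        \<longrightarrow> proportional v w)"

definition efficient_vecs :: "real mat \<Rightarrow> real vec set" where
  "efficient_vecs A = {w. efficient A w}"

(* The vector counterpart of mat_delete, with the same shift of the indices. *)
definition vec_delete :: "'a vec \<Rightarrow> nat \<Rightarrow> 'a vec" where
  "vec_delete w i = vec (dim_vec w - 1) (\<lambda>k. w $ (if k < i then k else Suc k))"

(* The set written E(A; i); mat_delete A i i is the principal submatrix A(i). *)
definition efficient_vecs_del :: "real mat \<Rightarrow> nat \<Rightarrow> real vec set" where
  "efficient_vecs_del A i =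
     {w \<in> efficient_vecs A. vec_delete w i \<in> efficient_vecs (mat_delete A i i)}"

end

theory Submission
  imports Defs
begin

text \<open>
  Attach to a matrix \<open>A\<close> and a positive vector \<open>w\<close> the digraph with an edge from \<open>i\<close> to \<open>j\<close> when
  \<open>w\<^sub>i / w\<^sub>j \<ge> a\<^sub>i\<^sub>j\<close>. The theorem is a statement about this digraph.

  First, efficiency is strong connectivity. If \<open>v\<close> is at least as good as \<open>w\<close>, then the ratio
  \<open>v\<^sub>i / w\<^sub>i\<close> cannot decrease along an edge, so in a strong digraph it is constant
  (\<open>strong_imp_efficient\<close>). Conversely, if no edge leaves a proper nonempty set \<open>X\<close> of indices, all
  ratios \<open>w\<^sub>i / w\<^sub>j\<close> from \<open>X\<close> to its complement are too small, and scaling up the entries in \<open>X\<close> a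
  little improves them all (\<open>efficient_imp_strong\<close>).

  Second, deleting the index \<open>i\<close> from \<open>A\<close> and \<open>w\<close> deletes the vertex \<open>i\<close> from the digraph. Since \<open>A\<close> is
  reciprocal, any two vertices are joined by an edge in at least one direction. For such digraphs
  with at least four vertices, strong connectivity survives the deletion of some vertex, which can
  be chosen different from any given vertex \<open>p\<close> (\<open>strong_delete_vertex\<close>): a largest strong proper
  vertex set containing \<open>p\<close> misses just one vertex.
\<close>

section \<open>Strong semicomplete digraphs\<close>

text \<open>
  Strong connectivity of the subdigraph induced on \<open>S\<close>, expressed by cuts instead of paths: every
  nonempty set of vertices that no edge leaves is everything. Both the passage to and from
  efficient vectors and the enlargement of strong sets meet the condition in this form.
\<close>

definition strong_on :: "'a set \<Rightarrow> ('a \<Rightarrow> 'a \<Rightarrow> bool) \<Rightarrow> bool" where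
  "strong_on S E \<longleftrightarrow>
     (\<forall>X\<subseteq>S. X \<noteq> {} \<longrightarrow> (\<forall>x\<in>X. \<forall>y\<in>S. E x y \<longrightarrow> y \<in> X) \<longrightarrow> X = S)"

definition semicomplete_on :: "'a set \<Rightarrow> ('a \<Rightarrow> 'a \<Rightarrow> bool) \<Rightarrow> bool" where
  "semicomplete_on S E \<longleftrightarrow> (\<forall>x\<in>S. \<forall>y\<in>S. x \<noteq> y \<longrightarrow> E x y \<or> E y x)"

lemma strong_onI:
  assumes "\<And>X. X \<subseteq> S \<Longrightarrow> X \<noteq> {} \<Longrightarrow> (\<And>x y. x \<in> X \<Longrightarrow> y \<in> S \<Longrightarrow> E x y \<Longrightarrow> y \<in> X) \<Longrightarrow> S \<subseteq> X"
  shows "strong_on S E"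
  unfolding strong_on_def using assms by (meson subset_antisym)

lemma strong_onD:
  assumes "strong_on S E" "X \<subseteq> S" "X \<noteq> {}" "\<And>x y. x \<in> X \<Longrightarrow> y \<in> S \<Longrightarrow> E x y \<Longrightarrow> y \<in> X"
  shows "X = S"
  using assms unfolding strong_on_def by blast

lemma strong_on_mono:
  assumes "strong_on S E" and "\<And>x y. x \<in> S \<Longrightarrow> y \<in> S \<Longrightarrow> E x y \<Longrightarrow> F x y"
  shows "strong_on S F"
proof (rule strong_onI)
  fix X assume X: "X \<subseteq> S" "X \<noteq> {}"
    and closed: "\<And>x y. x \<in> X \<Longrightarrow> y \<in> S \<Longrightarrow> F x y \<Longrightarrow> y \<in> X"
  have "y \<in> X" if "x \<in> X" "y \<in> S" "E x y" for x y
    using closed[OF that(1,2)] assms(2)[OF _ that(2,3)] that(1) X(1) by blast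
  then show "S \<subseteq> X" using strong_onD[OF assms(1) X] by blast
qed

lemma strong_on_pullback:
  assumes "strong_on T E" and "bij_betw f S T"
  shows "strong_on S (\<lambda>x y. E (f x) (f y))"
proof (rule strong_onI)
  fix X assume X: "X \<subseteq> S" "X \<noteq> {}" and closed: "\<And>x y. x \<in> X \<Longrightarrow> y \<in> S \<Longrightarrow> E (f x) (f y) \<Longrightarrow> y \<in> X"
  have T: "f ` S = T" and inj: "inj_on f S" using assms(2) by (auto simp: bij_betw_def)
  have "f ` X = T" using X closed T by (intro strong_onD[OF assms(1)]) blast+
  then show "S \<subseteq> X" using T inj X(1) by (metis inj_on_image_eq_iff order_refl)
qed

lemma strong_on_insert:
  assumes "strong_on S E" "s \<in> S" "E v s" "s' \<in> S" "E s' v"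
  shows "strong_on (insert v S) E"
proof (rule strong_onI)
  fix X assume X: "X \<subseteq> insert v S" "X \<noteq> {}"
    and closed: "\<And>x y. x \<in> X \<Longrightarrow> y \<in> insert v S \<Longrightarrow> E x y \<Longrightarrow> y \<in> X"
  have "X \<inter> S \<noteq> {}" using X closed[of v s] assms(2,3) by blast
  then have "X \<inter> S = S" using closed by (intro strong_onD[OF assms(1)]) blast+
  then show "insert v S \<subseteq> X" using closed[of s' v] assms(4,5) by blast
qed

text \<open>
  Every vertex of \<open>S\<close> lies on a triangle through the edge from \<open>a\<close> to \<open>b\<close>. This still applies after a
  vertex has been dropped from a strong set, when what remains of it may fail to be strong.
\<close>

lemma strong_on_triangles:
  assumes "S \<noteq> {}" "E a b" "\<And>s. s \<in> S \<Longrightarrow> E s a" "\<And>s. s \<in> S \<Longrightarrow> E b s"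
  shows "strong_on (insert a (insert b S)) E" (is "strong_on ?T E")
proof (rule strong_onI)
  fix X assume X: "X \<subseteq> ?T" "X \<noteq> {}"
    and closed: "\<And>x y. x \<in> X \<Longrightarrow> y \<in> ?T \<Longrightarrow> E x y \<Longrightarrow> y \<in> X"
  have b: "a \<in> X \<Longrightarrow> b \<in> X" using closed assms(2) by blast
  have S: "b \<in> X \<Longrightarrow> S \<subseteq> X" using closed assms(4) by blast
  have a: "X \<inter> S \<noteq> {} \<Longrightarrow> a \<in> X" using closed assms(3) by blast
  have "a \<in> X" using X a b S assms(1) by blast
  then show "?T \<subseteq> X" using b S by blast
qed

text \<open>
  An outside vertex with edges both to and from \<open>S\<close> can be added to \<open>S\<close>. If there is none, each
  outside vertex either receives edges from all of \<open>S\<close> or sends edges to all of \<open>S\<close>, and since \<open>V\<close> is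
  strong, some edge \<open>a \<rightarrow> b\<close> leads from the first kind to the second. Adding \<open>a\<close> and \<open>b\<close> can only exhaust \<open>V\<close> if \<open>S\<close> has two elements or more; then an element of \<open>S\<close> other
  than \<open>p\<close> is dropped in exchange.
\<close>

lemma strong_on_enlarge:
  assumes fin: "finite V" and card: "card V \<ge> 4" and strong: "strong_on V E"
    and semi: "semicomplete_on V E"
    and S: "S \<subseteq> V" "p \<in> S" "strong_on S E" "card S + 2 \<le> card V"
  shows "\<exists>T\<subseteq>V. p \<in> T \<and> strong_on T E \<and> card S < card T \<and> card T < card V"
proof (cases "\<exists>v\<in>V - S. (\<exists>s\<in>S. E v s) \<and> (\<exists>s\<in>S. E s v)")
  case True
  then obtain v where v: "v \<in> V - S" "strong_on (insert v S) E"
    using strong_on_insert[OF S(3)] by blast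
  have "finite S" using fin S(1) finite_subset by blast
  then show ?thesis using v S by (intro exI[of _ "insert v S"]) auto
next
  case False
  have finS: "finite S" using fin S(1) finite_subset by blast
  define Out where "Out = {v \<in> V - S. \<not> (\<exists>s\<in>S. E v s)}"
  have edge: "E s v \<or> E v s" if "v \<in> V - S" "s \<in> S" for s v
  proof -
    have "s \<in> V" "s \<noteq> v" using that S(1) by auto
    then show ?thesis using that(1) semi unfolding semicomplete_on_def by blast
  qed
  have Out: "E s v" if "v \<in> Out" "s \<in> S" for s v
    using that edge[of v s] unfolding Out_def by blast
  have noIn: "\<not> E s v" if "v \<in> V - S - Out" "s \<in> S" for s v
    using that False unfolding Out_def by blast
  have In: "E v s" if "v \<in> V - S - Out" "s \<in> S" for s v
    using that noIn[OF that] edge[of v s] by blast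
  have "S \<noteq> V" using S(4) by auto
  \<comment> \<open>If \<open>Out\<close> were empty, no edge would leave \<open>S\<close>.\<close>
  have "Out \<noteq> {}"
  proof
    assume "Out = {}"
    then have "S = V" using noIn S(1,2) by (intro strong_onD[OF strong]) blast+
    then show False using \<open>S \<noteq> V\<close> by simp
  qed
  \<comment> \<open>By definition no edge leads from \<open>Out\<close> back to \<open>S\<close>, so an edge leaving \<open>Out\<close> ends in the rest.\<close>
  obtain a b where ab: "a \<in> Out" "b \<in> V - S - Out" "E a b"
  proof (rule ccontr)
    assume "\<not> thesis"
    then have "Out = V"
      using \<open>Out \<noteq> {}\<close> that by (intro strong_onD[OF strong]) (auto simp: Out_def)
    then show False using S(1,2) by (auto simp: Out_def)
  qed
  have ab': "a \<in> V" "b \<in> V" "a \<notin> S" "b \<notin> S" "a \<noteq> b" using ab by (auto simp: Out_def)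
  have tri: "strong_on (insert a (insert b R)) E" if "R \<subseteq> S" "p \<in> R" for R
    using that by (intro strong_on_triangles ab(3) Out[OF ab(1)] In[OF ab(2)]) auto
  have cardR: "card (insert a (insert b R)) = card R + 2" if "R \<subseteq> S" for R
  proof -
    have "finite R" "a \<notin> R" "b \<notin> R" using that finS ab' finite_subset by auto
    then show ?thesis using \<open>a \<noteq> b\<close> by simp
  qed
  show ?thesis
  proof (cases "card S + 2 = card V")
    case False
    then show ?thesis
      using S ab' tri[of S] cardR[of S] by (intro exI[of _ "insert a (insert b S)"]) auto
  next
    case True
    then have "\<not> S \<subseteq> {p}" using card card_mono[of "{p}" S] by auto
    then obtain s where s: "s \<in> S" "s \<noteq> p" by blast
    have "card (S - {s}) + 1 = card S" using card_Suc_Diff1[OF finS s(1)] by simp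
    then show ?thesis
      using S ab' s True tri[of "S - {s}"] cardR[of "S - {s}"]
      by (intro exI[of _ "insert a (insert b (S - {s}))"]) auto
  qed
qed

lemma strong_delete_vertex:
  assumes fin: "finite V" and card: "card V \<ge> 4" and strong: "strong_on V E"
    and semi: "semicomplete_on V E" and p: "p \<in> V"
  obtains i where "i \<in> V" "i \<noteq> p" "strong_on (V - {i}) E"
proof -
  define F where "F = {T. T \<subseteq> V \<and> p \<in> T \<and> strong_on T E \<and> card T < card V}"
  have "strong_on {p} E" by (rule strong_onI) auto
  then have "{p} \<in> F" using p card by (auto simp: F_def)
  moreover have "\<forall>T. T \<in> F \<longrightarrow> card T < card V" by (simp add: F_def)
  ultimately have "\<exists>S. S \<in> F \<and> (\<forall>T. T \<in> F \<longrightarrow> card T \<le> card S)"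
    by (rule ex_has_greatest_nat)
  then obtain S where S: "S \<in> F" and max: "\<And>T. T \<in> F \<Longrightarrow> card T \<le> card S" by blast
  have sub: "S \<subseteq> V" "p \<in> S" "strong_on S E" "card S < card V" using S by (auto simp: F_def)
  have "\<not> card S + 2 \<le> card V"
  proof
    assume "card S + 2 \<le> card V"
    from strong_on_enlarge[OF fin card strong semi sub(1-3) this]
    obtain T where "T \<in> F" "card S < card T" unfolding F_def by blast
    then show False using max[of T] by simp
  qed
  then have "card (V - S) = 1"
    using fin sub by (simp add: card_Diff_subset finite_subset)
  then obtain i where i: "V - S = {i}" using card_1_singletonE by blast
  then have "V - {i} = S" using sub(1) by blast
  then show thesis using that[of i] i sub by auto
qed

section \<open>Efficiency as strong connectivity\<close>

definition ratio_digraph :: "real mat \<Rightarrow> real vec \<Rightarrow> nat \<Rightarrow> nat \<Rightarrow> bool" where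
  "ratio_digraph A w i j \<longleftrightarrow> A $$ (i, j) \<le> w $ i / w $ j"

text \<open>
  Along an edge \<open>w\<^sub>i / w\<^sub>j\<close> overshoots \<open>a\<^sub>i\<^sub>j\<close>, so a vector \<open>v\<close> that is at least as close must have
  \<open>v\<^sub>i / v\<^sub>j \<le> w\<^sub>i / w\<^sub>j\<close>, that is, \<open>v\<^sub>i / w\<^sub>i \<le> v\<^sub>j / w\<^sub>j\<close>. Around the cycles of a strong digraph these
  inequalities become equalities.
\<close>

lemma strong_imp_efficient:
  assumes w: "w \<in> pos_vecs (dim_row A)"
    and strong: "strong_on {..<dim_row A} (ratio_digraph A w)"
  shows "efficient A w"
  unfolding efficient_def
proof (intro conjI ballI impI)
  let ?n = "dim_row A"
  show "w \<in> pos_vecs ?n" by (rule w)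
  fix v assume v: "v \<in> pos_vecs ?n"
    and better: "\<forall>i<?n. \<forall>j<?n. \<bar>A $$ (i, j) - v $ i / v $ j\<bar> \<le> \<bar>A $$ (i, j) - w $ i / w $ j\<bar>"
  have pos: "v $ i > 0" "w $ i > 0" if "i < ?n" for i using that v w by (auto simp: pos_vecs_def)
  define u where "u i = v $ i / w $ i" for i
  have edge: "u i \<le> u j" if "i < ?n" "j < ?n" "ratio_digraph A w i j" for i j
  proof -
    have "v $ i / v $ j \<le> w $ i / w $ j"
      using better that unfolding ratio_digraph_def by (smt (verit))
    then show ?thesis using pos[OF that(1)] pos[OF that(2)]
      by (simp add: u_def field_simps)
  qed
  \<comment> \<open>The vertices with \<open>u\<close>-value at least \<open>u i\<close> form a set that no edge leaves.\<close>
  have le: "u i \<le> u j" if "i < ?n" "j < ?n" for i j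
  proof -
    have "{k \<in> {..<?n}. u i \<le> u k} = {..<?n}"
      using that edge by (intro strong_onD[OF strong]) (auto intro: order_trans)
    then show ?thesis using that by blast
  qed
  have "v = u 0 \<cdot>\<^sub>v w"
  proof (rule eq_vecI)
    show "dim_vec v = dim_vec (u 0 \<cdot>\<^sub>v w)" using v w by (auto simp: pos_vecs_def)
    fix i assume "i < dim_vec (u 0 \<cdot>\<^sub>v w)"
    then have i: "i < ?n" "i < dim_vec w" using w by (auto simp: pos_vecs_def)
    then have "u 0 = u i" using le[of 0 i] le[of i 0] by simp
    then show "v $ i = (u 0 \<cdot>\<^sub>v w) $ i" using i pos[OF i(1)] by (simp add: u_def)
  qed
  then show "proportional v w" by (auto simp: proportional_def)
qed

text \<open>
  Scaling \<open>w\<close> on a set \<open>X\<close> that no edge leaves changes only the ratios across the cut. All those from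
  \<open>X\<close> to its complement increase towards their targets; the inverse ratios decrease towards theirs
  because \<open>A\<close> is reciprocal. The result is not proportional to \<open>w\<close>, so \<open>w\<close> is not efficient.
\<close>

lemma efficient_imp_strong:
  assumes A: "A \<in> reciprocal_mats n" and eff: "efficient A w"
  shows "strong_on {..<n} (ratio_digraph A w)"
proof (rule strong_onI, rule ccontr)
  fix X assume X: "X \<subseteq> {..<n}" "X \<noteq> {}" "\<not> {..<n} \<subseteq> X"
    and closed: "\<And>x y. x \<in> X \<Longrightarrow> y \<in> {..<n} \<Longrightarrow> ratio_digraph A w x y \<Longrightarrow> y \<in> X"
  have n: "dim_row A = n" using A unfolding reciprocal_mats_def by blast
  have w: "w \<in> carrier_vec n" "\<And>i. i < n \<Longrightarrow> w $ i > 0"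
    using eff n by (auto simp: efficient_def pos_vecs_def)
  have a: "A $$ (i, j) > 0" "A $$ (j, i) = 1 / A $$ (i, j)" if "i < n" "j < n" for i j
    using A that unfolding reciprocal_mats_def by blast+
  \<comment> \<open>The largest factor for which no ratio from \<open>X\<close> to its complement overshoots its target.\<close>
  define Q where "Q = (\<lambda>(i, j). A $$ (i, j) * w $ j / w $ i) ` (X \<times> ({..<n} - X))"
  define t where "t = Min Q"
  have Q: "finite Q" "Q \<noteq> {}" using X finite_subset[OF X(1)] by (auto simp: Q_def)
  have "q > 1" if "q \<in> Q" for q
  proof -
    obtain i j where ij: "i \<in> X" "j < n" "j \<notin> X" "q = A $$ (i, j) * w $ j / w $ i"
      using \<open>q \<in> Q\<close> by (auto simp: Q_def)
    then have "i < n" using X(1) by auto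
    have "\<not> ratio_digraph A w i j" using closed[of i j] ij by auto
    then have "w $ i / w $ j < A $$ (i, j)" by (simp add: ratio_digraph_def)
    then show ?thesis
      unfolding ij(4) using w(2)[OF \<open>i < n\<close>] w(2)[OF \<open>j < n\<close>] by (simp add: field_simps)
  qed
  then have t: "t > 1" unfolding t_def using Min_in[OF Q] by blast
  have cross: "t * w $ i / w $ j \<le> A $$ (i, j)" if "i \<in> X" "j < n" "j \<notin> X" for i j
  proof -
    have "i < n" using that X(1) by auto
    have "t \<le> A $$ (i, j) * w $ j / w $ i"
      using Q that unfolding t_def by (intro Min_le) (auto simp: Q_def)
    then show ?thesis using w(2)[OF \<open>i < n\<close>] w(2)[OF \<open>j < n\<close>] by (simp add: field_simps)
  qed
  define v where "v = vec n (\<lambda>i. if i \<in> X then t * w $ i else w $ i)"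
  have v: "v $ i = (if i \<in> X then t * w $ i else w $ i)" if "i < n" for i
    using that by (simp add: v_def)
  have "v \<in> pos_vecs n" using w t by (auto simp: pos_vecs_def v_def)
  moreover have "\<bar>A $$ (i, j) - v $ i / v $ j\<bar> \<le> \<bar>A $$ (i, j) - w $ i / w $ j\<bar>"
    if ij: "i < n" "j < n" for i j
  proof -
    have up: "x / y \<le> t * x / y" if "x > 0" "y > 0" for x y :: real
      using that t by (simp add: field_simps)
    consider "i \<in> X \<longleftrightarrow> j \<in> X" | "i \<in> X" "j \<notin> X" | "i \<notin> X" "j \<in> X" by blast
    then show ?thesis
    proof cases
      case 1
      then have "v $ i / v $ j = w $ i / w $ j" using v ij t by auto
      then show ?thesis by simp
    next
      case 2
      then have "v $ i / v $ j = t * w $ i / w $ j" using v ij by auto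
      then show ?thesis using cross[of i j] up[of "w $ i" "w $ j"] w(2) ij 2 by auto
    next
      case 3
      then have eq: "v $ i / v $ j = w $ i / (t * w $ j)" using v ij by auto
      have "w $ i / (t * w $ j) \<le> w $ i / w $ j"
        using w(2)[OF ij(1)] w(2)[OF ij(2)] t by (simp add: field_simps)
      moreover have "A $$ (i, j) \<le> w $ i / (t * w $ j)"
        using cross[OF 3(2) ij(1) 3(1)] a(1)[OF ij(2,1)] w(2)[OF ij(1)] w(2)[OF ij(2)] t
        unfolding a(2)[OF ij(2,1)] by (simp add: field_simps)
      ultimately show ?thesis using eq by linarith
    qed
  qed
  ultimately have "proportional v w" using eff unfolding efficient_def n by blast
  then obtain c where c: "v = c \<cdot>\<^sub>v w" by (auto simp: proportional_def)
  have c': "v $ i = c * w $ i" if "i < n" for i using that c w(1) by simp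
  obtain i j where ij: "i \<in> X" "i < n" "j < n" "j \<notin> X" using X by blast
  have "c = t" using c'[of i] v[of i] w(2)[of i] ij by simp
  moreover have "c = 1" using c'[of j] v[of j] w(2)[of j] ij by simp
  ultimately show False using t by simp
qed

lemma semicomplete_ratio_digraph:
  assumes A: "A \<in> reciprocal_mats n" and w: "w \<in> pos_vecs n"
  shows "semicomplete_on {..<n} (ratio_digraph A w)"
  unfolding semicomplete_on_def
proof (intro ballI impI)
  fix i j assume ij: "i \<in> {..<n}" "j \<in> {..<n}"
  have pos: "A $$ (i, j) > 0" "w $ i > 0" "w $ j > 0" and rec: "A $$ (j, i) = 1 / A $$ (i, j)"
    using A w ij unfolding reciprocal_mats_def pos_vecs_def by blast+
  from pos show "ratio_digraph A w i j \<or> ratio_digraph A w j i"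
    unfolding ratio_digraph_def rec by (auto simp: field_simps)
qed

section \<open>Deleting an index\<close>

lemma bij_betw_insert_index:
  assumes "i < n"
  shows "bij_betw (insert_index i) {..<n - 1} ({..<n} - {i})"
proof -
  have "insert_index i ` {0..<n - 1} = {0..<Suc (n - 1)} - {i}"
    using assms by (intro insert_index_image) simp
  then show ?thesis
    using assms insert_index_inj_on by (simp add: bij_betw_def atLeast0LessThan)
qed

lemma efficient_delete:
  assumes A: "A \<in> carrier_mat n n" and w: "w \<in> pos_vecs n" and i: "i < n"
    and strong: "strong_on ({..<n} - {i}) (ratio_digraph A w)"
  shows "efficient (mat_delete A i i) (vec_delete w i)"
proof (rule strong_imp_efficient)
  let ?f = "insert_index i"
  have dim: "dim_row (mat_delete A i i) = n - 1" using A by simp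
  have A_entry: "mat_delete A i i $$ (k, l) = A $$ (?f k, ?f l)" if "k < n - 1" "l < n - 1" for k l
    using that A by (simp add: mat_delete_def insert_index_def)
  have w_entry: "vec_delete w i $ k = w $ ?f k" if "k < n - 1" for k
    using that w by (auto simp: vec_delete_def insert_index_def pos_vecs_def)
  have f: "?f k < n" if "k < n - 1" for k
    using that bij_betw_apply[OF bij_betw_insert_index[OF i]] by auto
  have "dim_vec w = n" using w unfolding pos_vecs_def by auto
  then have "vec_delete w i \<in> carrier_vec (n - 1)"
    using i unfolding vec_delete_def by (intro carrier_vecI) auto
  moreover have "vec_delete w i $ k > 0" if "k < n - 1" for k
    using w f[OF that] unfolding w_entry[OF that] pos_vecs_def by blast
  ultimately show "vec_delete w i \<in> pos_vecs (dim_row (mat_delete A i i))"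
    unfolding dim pos_vecs_def by blast
  have "strong_on {..<n - 1} (\<lambda>k l. ratio_digraph A w (?f k) (?f l))"
    by (rule strong_on_pullback[OF strong bij_betw_insert_index[OF i]])
  then show "strong_on {..<dim_row (mat_delete A i i)}
      (ratio_digraph (mat_delete A i i) (vec_delete w i))"
    unfolding dim
    by (rule strong_on_mono) (simp add: ratio_digraph_def A_entry w_entry)
qed

theorem corollary13:
  fixes n p :: nat and A :: "real mat"
  assumes "n \<ge> 4" and "A \<in> reciprocal_mats n" and "p < n"
  shows "efficient_vecs A = (\<Union>i\<in>{..<n}. efficient_vecs_del A i)
       \<and> (\<Union>i\<in>{..<n}. efficient_vecs_del A i) = (\<Union>i\<in>{..<n} - {p}. efficient_vecs_del A i)"
proof -
  have A: "A \<in> carrier_mat n n" using assms(2) unfolding reciprocal_mats_def by blast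
  have "efficient_vecs A \<subseteq> (\<Union>i\<in>{..<n} - {p}. efficient_vecs_del A i)"
  proof
    fix w assume "w \<in> efficient_vecs A"
    then have eff: "efficient A w" by (simp add: efficient_vecs_def)
    then have w: "w \<in> pos_vecs n" using A by (simp add: efficient_def)
    obtain i where i: "i \<in> {..<n}" "i \<noteq> p" "strong_on ({..<n} - {i}) (ratio_digraph A w)"
      using strong_delete_vertex[OF _ _ efficient_imp_strong[OF assms(2) eff]
          semicomplete_ratio_digraph[OF assms(2) w], of p] assms(1,3) by auto
    then have "efficient (mat_delete A i i) (vec_delete w i)"
      using efficient_delete[OF A w] by simp
    then show "w \<in> (\<Union>i\<in>{..<n} - {p}. efficient_vecs_del A i)"
      using i eff by (auto simp: efficient_vecs_del_def efficient_vecs_def)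
  qed
  moreover have "(\<Union>i\<in>{..<n}. efficient_vecs_del A i) \<subseteq> efficient_vecs A"
    by (auto simp: efficient_vecs_del_def)
  ultimately show ?thesis by blast
qed

end
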